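(* Let $\mathcal{E}$ be the projective plane cubic curve defined in $\mathbb{P}^2$ with homogeneous coordinates $(a:b:c)$ by $$q(a,b,c) = -c^3 - c^2(a+b) + c(a^2+ab+b^2) + (a^3+a^2b+ab^2+b^3)=0.$$ Then the set of rational points $\mathcal{E}(\mathbb{Q})$ is dense in the real curve $\mathcal{E}(\mathbb{R})$. Moreover, there are infinitely many pairwise non-similar integer Sharygin triangles.
   Context: Density is with respect to the usual (Euclidean) topology on $\mathcal{E}(\mathbb{R})\subset\mathbb{P}^2(\mathbb{R})$. For a (nondegenerate, Euclidean) triangle $ABC$, let $AA'$, $BB'$, $CC'$ be its (internal) angle bisectors, with $A'$ on side $BC$, $B'$ on side $AC$, $C'$ on side $AB$. The triangle $A'B'C'$ is called the bisectral triangle of $ABC$. A Sharygin triangle is a scalene triangle (three pairwise different side lengths) whose bisectral triangle is isosceles. An integer Sharygin triangle is a Sharygin triangle all of whose side lengths are integers. *)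

theory Defs
  imports "HOL-Analysis.Analysis"
begin

section \<open>The real projective plane\<close>

text \<open>A point of the real projective plane is a line through the origin of real 3-space,
  so \<^term>\<open>span {v}\<close> is the point with homogeneous coordinates \<open>(v$1 : v$2 : v$3)\<close>.
  The plane carries the quotient topology from the nonzero vectors.\<close>

definition proj_plane :: "(real^3) set set" where
  "proj_plane = {span {v} | v. v \<noteq> 0}"

definition proj_plane_topology :: "(real^3) set topology" where
  "proj_plane_topology =
     topology (\<lambda>U. U \<subseteq> proj_plane \<and> openin (top_of_set (- {0})) {v \<in> - {0}. span {v} \<in> U})"

lemma openin_proj_plane_topology:
  "openin proj_plane_topology U \<longleftrightarrow>
     U \<subseteq> proj_plane \<and> openin (top_of_set (- {0})) {v \<in> - {0}. span {v} \<in> U}"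
proof -
  let ?L = "\<lambda>U. U \<subseteq> proj_plane \<and>
    openin (top_of_set (- {0::real^3})) {v \<in> - {0}. span {v} \<in> U}"
  have "istopology ?L"
    unfolding istopology_def
  proof (intro conjI allI impI)
    fix S T :: "(real^3) set set"
    assume S: "?L S" and T: "?L T"
    have eq: "{v \<in> - {0::real^3}. span {v} \<in> S \<inter> T} =
          {v \<in> - {0}. span {v} \<in> S} \<inter> {v \<in> - {0}. span {v} \<in> T}" by auto
    show "S \<inter> T \<subseteq> proj_plane" using S by auto
    show "openin (top_of_set (- {0})) {v \<in> - {0::real^3}. span {v} \<in> S \<inter> T}"
      unfolding eq using S T by (intro openin_Int) auto
  next
    fix \<K> :: "(real^3) set set set"
    assume K: "\<forall>K\<in>\<K>. ?L K"
    have eq: "{v \<in> - {0::real^3}. span {v} \<in> \<Union>\<K>} = (\<Union>K\<in>\<K>. {v \<in> - {0}. span {v} \<in> K})"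
      by auto
    show "\<Union>\<K> \<subseteq> proj_plane" using K by auto
    show "openin (top_of_set (- {0})) {v \<in> - {0::real^3}. span {v} \<in> \<Union>\<K>}"
      unfolding eq using K by (intro openin_Union) auto
  qed
  then show ?thesis
    unfolding proj_plane_topology_def by (simp only: topology_inverse')
qed

lemma topspace_proj_plane_topology [simp]: "topspace proj_plane_topology = proj_plane"
proof
  show "topspace proj_plane_topology \<subseteq> proj_plane"
    by (auto simp: topspace_def openin_proj_plane_topology)
  have "{v \<in> - {0::real^3}. span {v} \<in> proj_plane} = topspace (top_of_set (- {0}))"
    by (auto simp: proj_plane_def)
  then have "openin proj_plane_topology proj_plane"
    unfolding openin_proj_plane_topology by (metis openin_topspace order_refl)
  then show "proj_plane \<subseteq> topspace proj_plane_topology"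
    by (rule openin_subset)
qed

lemma quotient_map_proj_plane:
  "quotient_map (top_of_set (- {0})) proj_plane_topology (\<lambda>v. span {v})"
  by (auto simp: quotient_map_def openin_proj_plane_topology proj_plane_def)


section \<open>The cubic curve\<close>

definition q :: "'a::comm_ring_1 \<Rightarrow> 'a \<Rightarrow> 'a \<Rightarrow> 'a" where
  "q a b c = - (c^3) - c^2 * (a + b) + c * (a^2 + a * b + b^2)
             + (a^3 + a^2 * b + a * b^2 + b^3)"

definition E_real :: "(real^3) set set" where
  "E_real = {span {v} | v. v \<noteq> 0 \<and> q (v$1) (v$2) (v$3) = 0}"

text \<open>A point is rational if it admits rational homogeneous coordinates.\<close>

definition E_rat :: "(real^3) set set" where
  "E_rat = {span {v} | v. v \<noteq> 0 \<and> (\<forall>i. v$i \<in> \<rat>) \<and> q (v$1) (v$2) (v$3) = 0}"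

lemma q_homogeneous: "q (k * a) (k * b) (k * c) = k^3 * q a b c"
  by (simp add: q_def algebra_simps power2_eq_square power3_eq_cube)

lemma span_in_E_real_iff:
  assumes "v \<noteq> 0"
  shows "span {v} \<in> E_real \<longleftrightarrow> q (v$1) (v$2) (v$3) = 0"
proof
  assume "span {v} \<in> E_real"
  then obtain w where w: "span {v} = span {w}" "q (w$1) (w$2) (w$3) = 0"
    by (auto simp: E_real_def)
  have "v \<in> span {v}" by (simp add: span_base)
  then have "v \<in> span {w}" by (simp only: w(1))
  then obtain k where "v = k *\<^sub>R w" by (auto simp: span_singleton)
  then show "q (v$1) (v$2) (v$3) = 0" by (simp add: q_homogeneous w)
qed (use assms in \<open>auto simp: E_real_def\<close>)


section \<open>Sharygin triangles\<close>

definition angle_at :: "real^2 \<Rightarrow> real^2 \<Rightarrow> real^2 \<Rightarrow> real" where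
  "angle_at P Q R = arccos (((P - Q) \<bullet> (R - Q)) / (norm (P - Q) * norm (R - Q)))"

text \<open>\<open>D\<close> is the endpoint on side \<open>BC\<close> of the internal bisector of the angle at \<open>A\<close>.\<close>

definition bisector_foot :: "real^2 \<Rightarrow> real^2 \<Rightarrow> real^2 \<Rightarrow> real^2 \<Rightarrow> bool" where
  "bisector_foot A B C D \<longleftrightarrow> D \<in> closed_segment B C \<and> angle_at B A D = angle_at D A C"

definition scalene :: "real^2 \<Rightarrow> real^2 \<Rightarrow> real^2 \<Rightarrow> bool" where
  "scalene A B C \<longleftrightarrow>
     dist A B \<noteq> dist B C \<and> dist B C \<noteq> dist C A \<and> dist C A \<noteq> dist A B"

definition isosceles :: "real^2 \<Rightarrow> real^2 \<Rightarrow> real^2 \<Rightarrow> bool" where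
  "isosceles A B C \<longleftrightarrow>
     dist A B = dist B C \<or> dist B C = dist C A \<or> dist C A = dist A B"

text \<open>Nondegeneracy is only required of \<open>ABC\<close>: the bisectral triangle of a
  nondegenerate triangle is automatically nondegenerate.\<close>

definition sharygin :: "real^2 \<Rightarrow> real^2 \<Rightarrow> real^2 \<Rightarrow> bool" where
  "sharygin A B C \<longleftrightarrow>
     \<not> collinear {A, B, C} \<and> scalene A B C \<and>
     (\<exists>A' B' C'. bisector_foot A B C A' \<and> bisector_foot B C A B' \<and> bisector_foot C A B C' \<and>
        isosceles A' B' C')"

definition integer_sharygin :: "real^2 \<Rightarrow> real^2 \<Rightarrow> real^2 \<Rightarrow> bool" where
  "integer_sharygin A B C \<longleftrightarrow>
     sharygin A B C \<and> dist A B \<in> \<int> \<and> dist B C \<in> \<int> \<and> dist C A \<in> \<int>"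

text \<open>Triangles are represented by ordered triples of vertices; similarity compares the
  vertex sets, so it disregards the order of the vertices (and allows reflections).\<close>

definition similar_triangles ::
    "(real^2) \<times> (real^2) \<times> (real^2) \<Rightarrow> (real^2) \<times> (real^2) \<times> (real^2) \<Rightarrow> bool" where
  "similar_triangles = (\<lambda>(A, B, C) (A', B', C').
     \<exists>f k. k > 0 \<and> (\<forall>x y. dist (f x) (f y) = k * dist x y) \<and>
       f ` {A, B, C} = {A', B', C'})"

end

theory Submission
  imports Defs "HOL-Real_Asymp.Real_Asymp"
begin

text \<open>The cubic has the Weierstrass model \<open>y\<^sup>2 = x\<^sup>3 + 5x\<^sup>2 - 32x\<close>. A suitable doubling orbit on it has
  strictly increasing numerators, so there are infinitely many rational points. By pigeonhole some
  differences of them lie arbitrarily close to the point at infinity. Translation by a rational point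
  close to infinity moves every point of the unbounded branch a little, in a fixed direction and
  without fixed points, so the rational points leave no gap there. Translation by (0, 0) carries
  density to the oval.

  Since q is the nontrivial factor of the condition that the bisectral triangle is isosceles, each of
  the infinitely many rational points with \<open>x < 4\<close> and \<open>y > 0\<close> on the unbounded branch yields an
  integer Sharygin triangle. Its perimeter divided by its longest side, which is invariant under
  similarity, determines x.\<close>

section \<open>Rational points on the Weierstrass model\<close>

definition cubic :: "real \<Rightarrow> real" where
  "cubic x = x^3 + 5 * x^2 - 32 * x"

text \<open>Vieta's formula for the sum of the roots dictates \<open>x''\<close>: it cancels the
  quadratic term of \<open>h\<close>, whose cubic terms cancel anyway. So \<open>h\<close> is
  affine, and being zero at \<open>x\<close> and \<open>x'\<close> it is zero everywhere.\<close>

lemma cubic_chord: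
  assumes "y^2 = cubic x" "y'^2 = cubic x'" "x \<noteq> x'"
  defines "m \<equiv> (y - y') / (x - x')"
  defines "x'' \<equiv> m^2 - 5 - x - x'"
  shows "(y + m * (x'' - x))^2 = cubic x''"
proof -
  have y': "y' = y + m * (x' - x)"
    using assms(3) unfolding m_def by (simp add: field_simps)
  define h where "h = (\<lambda>t. cubic t - (y + m * (t - x))^2 - (t - x) * (t - x') * (t - x''))"
  define k where "k = - 32 - m * (2 * y - 2 * m * x) - (x * x' + x'' * (x + x'))"
  have lin: "h t = h x + k * (t - x)" for t
    unfolding h_def k_def cubic_def x''_def by algebra
  have "h x = 0" "h x' = 0"
    using assms(1,2) unfolding h_def y' by simp_all
  then have "k = 0"
    using lin[of x'] assms(3) by simp
  then have "h x'' = 0"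
    using lin[of x''] \<open>h x = 0\<close> by simp
  then show ?thesis
    unfolding h_def by simp
qed

text \<open>A positive abscissa with nonzero ordinate lies on the unbounded branch;
  \<open>y > 0\<close> picks one of the two opposite points over it.\<close>

definition rat_abscissae :: "real set" where
  "rat_abscissae = {x \<in> \<rat>. x > 0 \<and> (\<exists>y\<in>\<rat>. y > 0 \<and> y^2 = cubic x)}"

lemma rat_abscissae_chord:
  assumes "x \<in> \<rat>" "y \<in> \<rat>" "y^2 = cubic x" "x' \<in> \<rat>" "y' \<in> \<rat>" "y'^2 = cubic x'" "x \<noteq> x'"
    and "((y - y') / (x - x'))^2 - 5 - x - x' > 0"
    and "cubic (((y - y') / (x - x'))^2 - 5 - x - x') > 0"
  shows "((y - y') / (x - x'))^2 - 5 - x - x' \<in> rat_abscissae"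
proof -
  define m where "m = (y - y') / (x - x')"
  define x'' where "x'' = m^2 - 5 - x - x'"
  define y'' where "y'' = y + m * (x'' - x)"
  have sq: "y''^2 = cubic x''"
    using cubic_chord[OF assms(3,6,7)] unfolding y''_def x''_def m_def .
  have rat: "m \<in> \<rat>" "x'' \<in> \<rat>" "y'' \<in> \<rat>"
    using assms unfolding m_def x''_def y''_def by auto
  have "y'' \<noteq> 0"
    using sq assms(9) unfolding x''_def m_def by auto
  \<comment> \<open>The third point of the chord may lie below the axis; reflecting it keeps the
    abscissa.\<close>
  then have "\<bar>y''\<bar> \<in> \<rat>" "\<bar>y''\<bar>^2 = cubic x''" "\<bar>y''\<bar> > 0"
    using rat sq by (auto simp: abs_if)
  then show ?thesis
    using rat assms(8) unfolding rat_abscissae_def x''_def m_def by blast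
qed

section \<open>Location of the unbounded branch\<close>

lemma cubic_pos_iff:
  assumes "x > 0"
  shows "cubic x > 0 \<longleftrightarrow> x^2 + 5 * x - 32 > 0"
proof -
  have "cubic x = x * (x^2 + 5 * x - 32)"
    unfolding cubic_def by (simp add: algebra_simps power2_eq_square power3_eq_cube)
  then show ?thesis
    using assms by (simp add: zero_less_mult_iff)
qed

text \<open>The branch starts at the root (sqrt 153 - 5)/2, about 3.68; 3 is a convenient integer
  below it.\<close>

lemma cubic_pos_imp_gt_3:
  assumes "x > 0" "cubic x > 0"
  shows "x > 3"
proof (rule ccontr)
  assume "\<not> x > 3"
  then have "x * x \<le> 3 * 3"
    using assms by (intro mult_mono) auto
  then show False
    using assms \<open>\<not> x > 3\<close> by (auto simp: cubic_pos_iff power2_eq_square)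
qed

lemma cubic_pos_mono:
  assumes "x > 0" "cubic x > 0" "x \<le> z"
  shows "cubic z > 0"
proof -
  have "x^2 \<le> z^2"
    using assms by (intro power_mono) auto
  moreover have "x^2 + 5 * x - 32 > 0"
    using assms cubic_pos_iff by blast
  ultimately have "z^2 + 5 * z - 32 > 0"
    using assms(3) by linarith
  then show ?thesis
    using assms cubic_pos_iff[of z] by simp
qed

text \<open>Such a triple gives the rational point \<open>x = 4 (u/v)\<^sup>2\<close>, \<open>y = 4 (u/v) (w/v\<^sup>2)\<close>. Doubling sends u/v to
  \<open>(u\<^sup>4 + 2v\<^sup>4) / (uvw)\<close>, a fraction in which only the primes 2, 3 and 17 could cancel; the parity
  conditions exclude 2, the condition \<open>3 dvd v\<close> excludes 3, and 17 is impossible since -2 is not a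
  fourth power modulo 17. The orbit starts with \<open>u/v = 83/57\<close>, which comes from 8 (8, 24).\<close>

definition quartic_pt :: "int \<Rightarrow> int \<Rightarrow> int \<Rightarrow> bool" where
  "quartic_pt u v w \<longleftrightarrow> u > 0 \<and> odd u \<and> odd v \<and> 3 dvd v \<and> coprime u v \<and>
     w^2 = 4 * u^4 + 5 * u^2 * v^2 - 8 * v^4"

section \<open>Arithmetic of the doubling orbit\<close>

lemma fourth_power_mod_17: "(x::int)^4 mod 17 \<in> {0, 1, 4, 13, 16}"
proof -
  have "x mod 17 \<in> {0,1,2,3,4,5,6,7,8,9,10,11,12,13,14,15,16}"
    by (simp, presburger)
  moreover have "x^4 mod 17 = (x mod 17)^4 mod 17"
    by (simp add: power_mod)
  ultimately show ?thesis
    by auto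
qed

text \<open>Twice a nonzero fourth power is 2, 8, 9 or 15 modulo 17. This set is closed under
  negation and contains no fourth power, so both summands must vanish.\<close>

lemma dvd_17_if_dvd:
  assumes "17 dvd (u::int)^4 + 2 * v^4"
  shows "17 dvd v"
proof -
  have "(a mod c + 2 * (b mod c)) mod c = (a + 2 * b) mod c" for a b c :: int
    by (metis mod_add_left_eq mod_add_right_eq mod_mult_right_eq)
  then have "(u^4 mod 17 + 2 * (v^4 mod 17)) mod 17 = 0"
    using assms by (simp only: dvd_eq_mod_eq_0)
  then have "v^4 mod 17 = 0"
    using fourth_power_mod_17[of u] fourth_power_mod_17[of v] by auto
  then have "17 dvd v^4"
    by (rule dvd_eq_mod_eq_0[THEN iffD2])
  moreover have "prime (17::int)"
    by simp
  ultimately show ?thesis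
    using prime_dvd_power by blast
qed

lemma quartic_pt_double:
  assumes "quartic_pt u v w"
  shows "quartic_pt (u^4 + 2 * v^4) (u * v * w)
    (2 * u^8 + 5 * u^6 * v^2 - 24 * u^4 * v^4 - 10 * u^2 * v^6 + 8 * v^8)"
proof -
  let ?n = "u^4 + 2 * v^4"
  from assms have u: "u > 0" "odd u" and v: "odd v" "3 dvd v" and uv: "coprime u v"
    and w: "w^2 = 4 * u^4 + 5 * u^2 * v^2 - 8 * v^4"
    by (auto simp: quartic_pt_def)
  have "odd (w^2)"
    unfolding w using u v by simp
  then have odd_w: "odd w"
    by simp
  have "coprime ?n (u * v * w)"
  proof (rule ccontr)
    assume "\<not> coprime ?n (u * v * w)"
    then have "\<not> is_unit (gcd ?n (u * v * w))"
      using is_unit_gcd by blast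
    moreover have "gcd ?n (u * v * w) \<noteq> 0"
      using u v odd_w by auto
    ultimately obtain p where "prime p" "p dvd gcd ?n (u * v * w)"
      using prime_divisor_exists by blast
    then have p: "prime p" "p dvd ?n" "p dvd u * v * w"
      by auto
    have "\<not> p dvd v"
    proof
      assume "p dvd v"
      then have "p dvd 2 * v^4"
        by (simp add: dvd_trans[OF _ dvd_power])
      then have "p dvd u^4"
        using p(2) dvd_add_left_iff by blast
      then show False
        using p(1) uv \<open>p dvd v\<close> prime_dvd_power not_coprimeI not_prime_unit by metis
    qed
    have "\<not> p dvd 2"
    proof
      assume "p dvd 2"
      then have "p = 2"
        using p(1) by (simp add: primes_dvd_imp_eq)
      then show False
        using p(2) u(2) by simp
    qed
    have "\<not> p dvd u"
    proof
      assume "p dvd u"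
      then have "p dvd u^4"
        by (simp add: dvd_trans[OF _ dvd_power])
      then have "p dvd 2 * v^4"
        using p(2) dvd_add_right_iff by blast
      then show False
        using p(1) \<open>\<not> p dvd v\<close> \<open>\<not> p dvd 2\<close> prime_dvd_mult_iff prime_dvd_power by blast
    qed
    then have "p dvd w"
      using p \<open>\<not> p dvd v\<close> by (simp add: prime_dvd_mult_iff)
    then have "p dvd w^2"
      by (simp add: dvd_trans[OF _ dvd_power])
    \<comment> \<open>Elimination of \<open>u\<close>: since
      \<open>w^2 - 4 * ?n = v^2 * (5 * u^2 - 16 * v^2)\<close>, the conjugate factor leaves only
      \<open>u^4\<close>, which \<open>?n\<close> removes; 306 = 25 * 2 + 256.\<close>
    moreover have "306 * v^6 = (25 * v^2) * ?n - (5 * u^2 + 16 * v^2) * (w^2 - 4 * ?n)"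
      unfolding w by algebra
    ultimately have "p dvd 306 * v^6"
      using p(2) by (metis dvd_diff dvd_mult)
    then have "p dvd 306"
      using \<open>\<not> p dvd v\<close> p(1) prime_dvd_mult_iff prime_dvd_power by blast
    moreover have "306 = 2 * (3 * (3 * (17::int)))"
      by simp
    ultimately have "p dvd 3 \<or> p dvd 17"
      using p(1) \<open>\<not> p dvd 2\<close> by (metis prime_dvd_mult_iff)
    then have "p = 3 \<or> p = 17"
      using p(1) primes_dvd_imp_eq[of p] by auto
    then show False
      using v(2) \<open>\<not> p dvd v\<close> dvd_17_if_dvd p(2) by auto
  qed
  moreover have "(2 * u^8 + 5 * u^6 * v^2 - 24 * u^4 * v^4 - 10 * u^2 * v^6 + 8 * v^8)^2 =
      4 * ?n^4 + 5 * ?n^2 * (u * v * w)^2 - 8 * (u * v * w)^4"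
  proof -
    \<comment> \<open>Only even powers of \<open>w\<close> occur, so the quartic equation turns the
      claim into a polynomial identity in \<open>u\<close> and \<open>v\<close>.\<close>
    have "5 * ?n^2 * (u * v * w)^2 - 8 * (u * v * w)^4 =
        5 * ?n^2 * u^2 * v^2 * w^2 - 8 * u^4 * v^4 * (w^2)^2"
      by algebra
    then show ?thesis
      unfolding w by algebra
  qed
  moreover have "?n > 0"
    using u by (intro add_pos_nonneg) auto
  ultimately show ?thesis
    using u v odd_w unfolding quartic_pt_def by simp
qed

lemma quartic_pt_large: "\<exists>u v w. quartic_pt u v w \<and> u > int n"
proof (induction n)
  case 0
  have "coprime (83::int) 57"
    by (simp add: coprime_iff_gcd_eq_1 gcd_non_0_int)
  then have "quartic_pt 83 57 14741"
    by (simp add: quartic_pt_def)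
  then show ?case
    by (metis of_nat_0 quartic_pt_def)
next
  case (Suc n)
  then obtain u v w where uvw: "quartic_pt u v w" "u > int n"
    by blast
  have "u \<ge> 1" "odd v"
    using uvw by (auto simp: quartic_pt_def)
  then have "v \<noteq> 0"
    by auto
  \<comment> \<open>As \<open>v\<close> is nonzero, each doubling strictly enlarges the
    numerator.\<close>
  then have "v^4 > 0"
    by (simp add: zero_less_power_eq)
  moreover have "u \<le> u^4"
    using \<open>u \<ge> 1\<close> by (intro self_le_power) auto
  ultimately have "u^4 + 2 * v^4 > int (Suc n)"
    using uvw(2) by linarith
  then show ?case
    using quartic_pt_double[OF uvw(1)] by blast
qed

text \<open>The numerators are unbounded and the fractions \<open>u / V u\<close> are in lowest
  terms, so different numerators give different abscissae.\<close>

lemma infinite_rat_abscissae: "infinite rat_abscissae"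
proof -
  define U where "U = {u. \<exists>v w. quartic_pt u v w}"
  define V where "V = (\<lambda>u. SOME v. \<exists>w. quartic_pt u v w)"
  have V: "\<exists>w. quartic_pt u (V u) w" if "u \<in> U" for u
    using that unfolding U_def V_def by (auto intro: someI_ex[of "\<lambda>v. \<exists>w. quartic_pt u v w"])
  have "\<exists>u\<in>U. u > b" for b
  proof -
    have "b \<le> int (nat b)"
      by simp
    then show ?thesis
      using quartic_pt_large[of "nat b"] unfolding U_def by fastforce
  qed
  then have inf: "infinite U"
    by (meson Max_ge finite_has_maximal linorder_not_less order.asym)
  define X where "X = (\<lambda>u. 4 * (real_of_int u / real_of_int (V u))^2)"
  have "inj_on X U"
  proof (rule inj_onI)
    fix u u' assume mem: "u \<in> U" "u' \<in> U" and eq: "X u = X u'"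
    obtain w w' where w: "quartic_pt u (V u) w" "quartic_pt u' (V u') w'"
      using V mem by blast
    then have nz: "V u \<noteq> 0" "V u' \<noteq> 0" "u > 0" "u' > 0"
      by (auto simp: quartic_pt_def)
    have cop: "coprime (u^2) (V u ^2)" "coprime (u'^2) (V u' ^2)"
      using w by (auto simp: quartic_pt_def)
    have "real_of_int (u^2 * V u' ^2) = real_of_int (u'^2 * V u ^2)"
      using eq nz unfolding X_def by (simp add: field_simps)
    then have e: "u^2 * V u' ^2 = u'^2 * V u ^2"
      by linarith
    have "u^2 dvd u'^2"
      using e cop(1) by (metis coprime_dvd_mult_left_iff dvd_triv_left)
    moreover have "u'^2 dvd u^2"
      using e cop(2) by (metis coprime_dvd_mult_left_iff dvd_triv_left)
    ultimately show "u = u'"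
      using nz by (simp add: zdvd_antisym_nonneg)
  qed
  moreover have "X ` U \<subseteq> rat_abscissae"
  proof safe
    fix u assume "u \<in> U"
    then obtain w where w: "quartic_pt u (V u) w"
      using V by blast
    define r where "r = real_of_int u / real_of_int (V u)"
    define y where "y = 4 * r * (real_of_int w / real_of_int (V u)^2)"
    have nz: "V u \<noteq> 0" "u > 0" "odd (V u)" "odd u"
      and w2: "w^2 = 4 * u^4 + 5 * u^2 * V u ^2 - 8 * V u ^4"
      using w by (auto simp: quartic_pt_def)
    have "odd (w^2)"
      unfolding w2 using nz by simp
    then have "w \<noteq> 0"
      by auto
    have "real_of_int (w^2) = real_of_int (4 * u^4 + 5 * u^2 * V u ^2 - 8 * V u ^4)"
      using w2 by simp
    then have "real_of_int w^2 = 4 * real_of_int u^4 + 5 * real_of_int u^2 * real_of_int (V u)^2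
        - 8 * real_of_int (V u)^4"
      by simp
    moreover have "(real_of_int w / real_of_int (V u)^2)^2 = real_of_int w^2 / real_of_int (V u)^4"
      by (simp add: power_divide flip: power_mult)
    ultimately have "(real_of_int w / real_of_int (V u)^2)^2 = 4 * r^4 + 5 * r^2 - 8"
      using nz unfolding r_def
      by (simp add: diff_divide_distrib add_divide_distrib power_divide)
        (simp add: power2_eq_square power4_eq_xxxx)
    \<comment> \<open>\<open>cubic (4 * r^2)\<close> is \<open>16 * r^2\<close> times the right-hand
      side just shown to be a square.\<close>
    then have "y^2 = cubic (4 * r^2)"
      unfolding y_def cubic_def power_mult_distrib by algebra
    moreover have "y \<noteq> 0" "r \<noteq> 0"
      using nz \<open>w \<noteq> 0\<close> unfolding y_def r_def by auto
    moreover have "r \<in> \<rat>" "y \<in> \<rat>"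
      unfolding y_def r_def by auto
    ultimately have "4 * r^2 \<in> rat_abscissae"
      unfolding rat_abscissae_def by (auto intro!: bexI[of _ "\<bar>y\<bar>"])
    then show "X u \<in> rat_abscissae"
      unfolding X_def r_def .
  qed
  ultimately show ?thesis
    using inf infinite_super finite_imageD by metis
qed

section \<open>Density on the unbounded branch\<close>

text \<open>Pigeonhole on cells of length \<open>d\<close>: a bounded set meets finitely many of
  them, so two elements share a cell.\<close>

lemma close_pair_if_infinite:
  fixes S :: "real set"
  assumes "infinite S" "S \<subseteq> {0..b}" "d > 0"
  shows "\<exists>x\<in>S. \<exists>y\<in>S. x \<noteq> y \<and> \<bar>x - y\<bar> < d"
proof -
  define h where "h = (\<lambda>x. \<lfloor>x / d\<rfloor>)"
  have "h ` S \<subseteq> {0..\<lfloor>b / d\<rfloor>}"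
    using assms(2,3) unfolding h_def by (force intro!: floor_mono divide_right_mono)
  then have "finite (h ` S)"
    using finite_subset by blast
  then have "\<not> inj_on h S"
    using assms(1) finite_imageD by blast
  then obtain x y where xy: "x \<in> S" "y \<in> S" "x \<noteq> y" "h x = h y"
    unfolding inj_on_def by blast
  have "\<bar>x / d - y / d\<bar> < 1"
    using xy(4) unfolding h_def by linarith
  then have "\<bar>x - y\<bar> < d"
    using assms(3) by (simp add: field_simps abs_if split: if_splits)
  then show ?thesis
    using xy by blast
qed

lemma rat_abscissaeD:
  assumes "x \<in> rat_abscissae"
  shows "x \<in> \<rat>" "x > 3" "cubic x > 0"
proof -
  obtain y where y: "y > 0" "y^2 = cubic x" "x > 0"
    using assms unfolding rat_abscissae_def by blast
  have "0 < y^2"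
    using y(1) by simp
  then show "cubic x > 0"
    unfolding y(2) .
  with y(3) show "x > 3"
    by (rule cubic_pos_imp_gt_3)
  show "x \<in> \<rat>"
    using assms unfolding rat_abscissae_def by blast
qed

text \<open>If the abscissae of rational points were bounded, two of these points would have arbitrarily
  close ordinates, and the difference of these two points would have a large abscissa.\<close>

lemma rat_abscissae_unbounded: "\<exists>x\<in>rat_abscissae. x > b"
proof (rule ccontr)
  assume "\<not> ?thesis"
  then have bdd: "x \<le> b" if "x \<in> rat_abscissae" for x
    using that by force
  define Y where "Y = {y \<in> \<rat>. y > 0 \<and> (\<exists>x\<in>rat_abscissae. y^2 = cubic x)}"
  have mem: "x > 3 \<and> cubic x > 0 \<and> x \<in> \<rat>" if "x \<in> rat_abscissae" for x
    using rat_abscissaeD[OF that] by blast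
  have b: "b > 3"
    using infinite_rat_abscissae mem bdd by (metis ex_in_conv finite.emptyI less_le_trans)
  \<comment> \<open>This is the difference quotient of \<open>cubic\<close>; at
    \<open>x = x' = 3\<close> it equals 27 + 30 - 32 = 25. Hence \<open>cubic\<close> is injective
    and increasing beyond 3.\<close>
  have slope: "x^2 + x * x' + x'^2 + 5 * (x + x') - 32 > 25"
    if "x > 3" "x' > 3" for x x' :: real
  proof -
    have "9 < x * x" "9 < x * x'" "9 < x' * x'"
      using that mult_strict_mono[of 3 x 3 x] mult_strict_mono[of 3 x 3 x']
        mult_strict_mono[of 3 x' 3 x'] by simp_all
    then show ?thesis
      using that by (simp add: power2_eq_square)
  qed
  have diff: "cubic x - cubic x' = (x - x') * (x^2 + x * x' + x'^2 + 5 * (x + x') - 32)" for x x'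
    unfolding cubic_def by algebra
  have "Y \<subseteq> {0..sqrt (cubic b)}"
  proof
    fix y assume "y \<in> Y"
    then obtain x where x: "y > 0" "x \<in> rat_abscissae" "y^2 = cubic x"
      unfolding Y_def by blast
    have "cubic x \<le> cubic b"
      using diff[of b x] slope[of b x] mem[OF x(2)] bdd[OF x(2)] b
      mult_nonneg_nonneg[of "b - x" "b^2 + b * x + x^2 + 5 * (b + x) - 32"] by linarith
    then show "y \<in> {0..sqrt (cubic b)}"
      using x by (auto intro!: real_le_rsqrt)
  qed
  moreover have "infinite Y"
  proof
    assume "finite Y"
    moreover have "(\<lambda>x. sqrt (cubic x)) ` rat_abscissae \<subseteq> Y"
      unfolding Y_def rat_abscissae_def by (auto simp: real_sqrt_unique)
    moreover have "inj_on (\<lambda>x. sqrt (cubic x)) rat_abscissae"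
    proof (rule inj_onI)
      fix x x' assume *: "x \<in> rat_abscissae" "x' \<in> rat_abscissae" "sqrt (cubic x) = sqrt (cubic x')"
      then have "cubic x = cubic x'"
        by simp
      then show "x = x'"
        using diff[of x x'] slope[of x x'] mem[OF *(1)] mem[OF *(2)] by auto
    qed
    ultimately show False
      using infinite_rat_abscissae finite_subset finite_imageD by metis
  qed
  \<comment> \<open>Chosen so that the chord below has squared slope above \<open>3 * b + 5\<close>;
    subtracting \<open>5 + x + x'\<close>, at most \<open>5 + 2 * b\<close>, still leaves more than
    \<open>b\<close>.\<close>
  moreover define d where "d = 1 / (3 * b + 5)"
  moreover have "d > 0"
    using b unfolding d_def by simp
  ultimately obtain y y' where y: "y \<in> Y" "y' \<in> Y" "y \<noteq> y'" "\<bar>y - y'\<bar> < d"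
    using close_pair_if_infinite by meson
  obtain x x' where x: "x \<in> rat_abscissae" "y^2 = cubic x" "x' \<in> rat_abscissae" "y'^2 = cubic x'"
    and y_rat: "y \<in> \<rat>" "y' \<in> \<rat>" and y_pos: "y > 0" "y' > 0"
    using y(1,2) unfolding Y_def by blast
  have ne: "x \<noteq> x'"
    using x y_pos y(3) by (metis power2_eq_iff_nonneg less_imp_le)
  define D where "D = x^2 + x * x' + x'^2 + 5 * (x + x') - 32"
  have D: "D > 25"
    using slope mem x unfolding D_def by blast
  have "(y - y') * (y + y') = (x - x') * D"
    using diff[of x x'] x unfolding D_def by (simp add: power2_eq_square algebra_simps)
  \<comment> \<open>Reflecting the second point makes the chord steep when the two ordinates are
    close.\<close>
  then have m: "(y + y') / (x - x') = D / (y - y')"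
    using ne y(3) by (simp add: field_simps)
  have "3 * b + 5 < \<bar>D / (y - y')\<bar>"
  proof -
    have "\<bar>y - y'\<bar> * (3 * b + 5) < 1"
      using y(4) b unfolding d_def by (simp add: field_simps)
    then show ?thesis
      using D y(3) by (simp add: field_simps abs_divide)
  qed
  moreover have "3 * b + 5 < (3 * b + 5)^2"
    using b by (simp add: power2_eq_square)
  ultimately have big: "3 * b + 5 < ((y - - y') / (x - x'))^2"
    using b m power_strict_mono[of "3 * b + 5" "\<bar>D / (y - y')\<bar>" 2] by (simp add: power_divide)
  define z where "z = ((y - - y') / (x - x'))^2 - 5 - x - x'"
  have z: "z > b"
    using big bdd[OF x(1)] bdd[OF x(3)] unfolding z_def by linarith
  then have "cubic z > 0"
    using cubic_pos_mono[of x z] mem[OF x(1)] bdd[OF x(1)] by simp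
  then have "z \<in> rat_abscissae"
    using rat_abscissae_chord[of x y x' "- y'"] x y_rat mem ne z b unfolding z_def by auto
  then show False
    using z bdd by fastforce
qed

section \<open>Small translations by points near infinity\<close>

definition chord_abscissa :: "real \<Rightarrow> real \<Rightarrow> real" where
  "chord_abscissa t x = ((sqrt (cubic x) - sqrt (cubic t)) / (x - t))^2 - 5 - x - t"


text \<open>As the point over \<open>t\<close> goes to infinity, the chord becomes vertical and its
  third point tends to the reflection of the point over \<open>x\<close>.\<close>

lemma chord_abscissa_tendsto:
  "((\<lambda>t. chord_abscissa t x) \<longlongrightarrow> x) at_top"
  unfolding chord_abscissa_def cubic_def by real_asymp

text \<open>With \<open>s = sqrt (cubic x)\<close>, the leading correction to the limit
  \<open>x\<close> is \<open>- 2 * s / sqrt t\<close>, which is negative.\<close>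

lemma chord_abscissa_less:
  assumes "cubic x > 0"
  shows "eventually (\<lambda>t. chord_abscissa t x < x) at_top"
proof -
  define s where "s = sqrt (cubic x)"
  have s: "s > 0" "s^2 = x^3 + 5 * x^2 - 32 * x"
    using assms unfolding s_def cubic_def by auto
  have "eventually (\<lambda>t. ((s - sqrt (t^3 + 5 * t^2 - 32 * t)) / (x - t))^2 - 5 - x - t < x) at_top"
    using s(1) by real_asymp
  then show ?thesis
    unfolding chord_abscissa_def s_def cubic_def .
qed

text \<open>Translating by a point close to infinity moves the right end of a gap slightly to the left,
  hence into the gap.\<close>

lemma rat_abscissae_dense:
  assumes "l > 0" "cubic l > 0" "l < r"
  shows "\<exists>x\<in>rat_abscissae. l < x \<and> x < r"
proof (rule ccontr)
  assume gap: "\<not> ?thesis"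
  \<comment> \<open>\<open>S\<close> contains all rational abscissae beyond \<open>l\<close>, so its
    infimum \<open>c\<close> is the right end of the gap.\<close>
  define S where "S = {x \<in> rat_abscissae. l < x}"
  define c where "c = Inf S"
  obtain x0 where "x0 \<in> S"
    using rat_abscissae_unbounded[of l] unfolding S_def by blast
  have bdd: "bdd_below S"
    unfolding S_def by (rule bdd_belowI[of _ l]) auto
  have "r \<le> c"
    unfolding c_def using \<open>x0 \<in> S\<close> gap unfolding S_def by (intro cInf_greatest) force+
  then have "l < c"
    using assms(3) by simp
  then have c: "c > 0" "cubic c > 0"
    using assms cubic_pos_mono[of l c] by auto
  have "eventually (\<lambda>t. l < chord_abscissa t c \<and> chord_abscissa t c < c) at_top"
    using order_tendstoD(1)[OF chord_abscissa_tendsto \<open>l < c\<close>] chord_abscissa_less[OF c(2)]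
    by (rule eventually_conj)
  then obtain T where T: "l < chord_abscissa t c \<and> chord_abscissa t c < c" if "t \<ge> T" for t
    unfolding eventually_at_top_linorder by blast
  obtain t where t: "t \<in> rat_abscissae" "t > max T c"
    using rat_abscissae_unbounded by blast
  have "isCont (\<lambda>x. chord_abscissa t x) c"
    unfolding chord_abscissa_def cubic_def using t(2) by (auto intro!: continuous_intros)
  moreover have "l < chord_abscissa t c" "chord_abscissa t c < c"
    using T t(2) by auto
  ultimately have "eventually (\<lambda>x. l < chord_abscissa t x) (at c)"
    "eventually (\<lambda>x. chord_abscissa t x < c) (at c)"
    unfolding isCont_def by (auto dest: order_tendstoD)
  moreover have "eventually (\<lambda>x. x < t) (at c)"
    using t(2) by (intro order_tendstoD(2)[OF tendsto_ident_at]) auto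
  \<comment> \<open>The infimum \<open>c\<close> need not be attained, so the strict inequalities
    are spread to a neighbourhood containing some element of \<open>S\<close>; \<open>x < t\<close>
    keeps the chord non-vertical.\<close>
  ultimately have "eventually (\<lambda>x. l < chord_abscissa t x \<and> chord_abscissa t x < c \<and> x < t) (nhds c)"
    using t(2) T[of t] unfolding eventually_nhds_conv_at by (auto intro: eventually_conj)
  then obtain e where e: "e > 0"
    "\<And>x. dist x c < e \<Longrightarrow> l < chord_abscissa t x \<and> chord_abscissa t x < c \<and> x < t"
    unfolding eventually_nhds_metric by blast
  have "\<exists>x\<in>S. x < c + e"
    using cInf_less_iff[of S "c + e"] \<open>x0 \<in> S\<close> bdd e(1) unfolding c_def by auto
  then obtain x where x: "x \<in> S" "x < c + e"
    by blast
  have "c \<le> x"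
    unfolding c_def using x(1) bdd by (rule cInf_lower)
  then have ch: "l < chord_abscissa t x" "chord_abscissa t x < c" "x < t"
    using e(2)[of x] x(2) by (auto simp: dist_real_def)
  have "cubic (chord_abscissa t x) > 0"
    using ch assms cubic_pos_mono[of l] by simp
  moreover obtain y where y: "y \<in> \<rat>" "y > 0" "y^2 = cubic x" "x \<in> \<rat>"
    using x(1) unfolding S_def rat_abscissae_def by blast
  moreover obtain y' where y': "y' \<in> \<rat>" "y' > 0" "y'^2 = cubic t" "t \<in> \<rat>"
    using t(1) unfolding rat_abscissae_def by blast
  moreover have "sqrt (cubic x) = y" "sqrt (cubic t) = y'"
    using y y' by (auto intro: real_sqrt_unique)
  ultimately have "chord_abscissa t x \<in> rat_abscissae"
    using rat_abscissae_chord[of x y t y'] ch assms(1) unfolding chord_abscissa_def by simp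
  then have "chord_abscissa t x \<in> S"
    using ch unfolding S_def by simp
  then show False
    using cInf_lower[OF _ bdd] ch unfolding c_def by fastforce
qed

section \<open>Density on the whole affine curve\<close>

definition rat_points :: "(real \<times> real) set" where
  "rat_points = {(x, y). x \<in> \<rat> \<and> y \<in> \<rat> \<and> y^2 = cubic x}"

lemma isCont_cubic: "isCont cubic x"
  unfolding cubic_def by (intro continuous_intros)

lemma sqrt_cubic_in_closure_rat_points:
  assumes "x > 0" "cubic x > 0" "\<bar>s\<bar> = 1"
  shows "(x, s * sqrt (cubic x)) \<in> closure rat_points"
proof -
  \<comment> \<open>Approximation from the right stays on the unbounded branch; \<open>s\<close>
    selects its upper or lower half.\<close>
  have "\<forall>n. \<exists>z\<in>rat_abscissae. x < z \<and> z < x + 1 / real (Suc n)"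
    using rat_abscissae_dense[OF assms(1,2)] by simp
  then obtain z where z: "z n \<in> rat_abscissae" "x < z n" "z n < x + 1 / real (Suc n)" for n
    by metis
  have "(\<lambda>n. x + 1 / real (Suc n)) \<longlonglongrightarrow> x + 0"
    by (intro tendsto_intros LIMSEQ_Suc lim_1_over_n)
  then have lim: "z \<longlonglongrightarrow> x"
    using z by (intro tendsto_sandwich[of "\<lambda>_. x" z _ "\<lambda>n. x + 1 / real (Suc n)"])
      (auto intro!: always_eventually less_imp_le simp del: of_nat_Suc)
  have "(\<lambda>n. (z n, s * sqrt (cubic (z n)))) \<longlonglongrightarrow> (x, s * sqrt (cubic x))"
    by (intro tendsto_intros lim isCont_tendsto_compose[OF isCont_cubic])
  moreover have "(z n, s * sqrt (cubic (z n))) \<in> rat_points" for n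
  proof -
    obtain y where y: "y \<in> \<rat>" "y > 0" "y^2 = cubic (z n)"
      using z(1)[of n] unfolding rat_abscissae_def by blast
    have "s = 1 \<or> s = -1"
      using assms(3) by linarith
    moreover have "sqrt (cubic (z n)) = y"
      using y by (auto intro: real_sqrt_unique)
    ultimately show ?thesis
      using y rat_abscissaeD(1)[OF z(1)] unfolding rat_points_def by auto
  qed
  ultimately show ?thesis
    unfolding closure_sequential by (intro exI[of _ "\<lambda>n. (z n, s * sqrt (cubic (z n)))"]) simp
qed

lemma closure_rat_points_pos:
  assumes "x > 0" "y^2 = cubic x"
  shows "(x, y) \<in> closure rat_points"
proof -
  define s where "s = (if y < 0 then -1 else 1 :: real)"
  have y: "y = s * sqrt (cubic x)"
    unfolding s_def using assms(2)[symmetric] by simp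
  have s: "\<bar>s\<bar> = 1"
    unfolding s_def by simp
  show ?thesis
  proof (cases "y = 0")
    case False
    then have "cubic x > 0"
      using assms(2) by (metis zero_less_power2)
    then show ?thesis
      unfolding y using sqrt_cubic_in_closure_rat_points assms(1) s by blast
  next
    case True
    then have "cubic x = 0"
      using assms(2) by simp
    \<comment> \<open>This is the leftmost point of the branch. Points of the curve over abscissae
      just to its right already lie in the closure, which is closed.\<close>
    have pos: "cubic (x + 1 / real (Suc n)) > 0" for n
    proof -
      define h where "h = 1 / real (Suc n)"
      have "h > 0"
        unfolding h_def by simp
      have "x * (x^2 + 5 * x - 32) = 0"
        using \<open>cubic x = 0\<close> unfolding cubic_def by algebra
      then have "x^2 + 5 * x - 32 = 0"
        using assms(1) by simp
      moreover have "(x + h)^2 + 5 * (x + h) - 32 = (x^2 + 5 * x - 32) + h * (2 * x + h + 5)"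
        by algebra
      ultimately have "(x + h)^2 + 5 * (x + h) - 32 > 0"
        using assms(1) \<open>h > 0\<close> by simp
      then show ?thesis
        using cubic_pos_iff[of "x + h"] assms(1) \<open>h > 0\<close> unfolding h_def[symmetric] by simp
    qed
    have "(x + 1 / real (Suc n), s * sqrt (cubic (x + 1 / real (Suc n)))) \<in> closure rat_points" for n
      using assms(1) s by (intro sqrt_cubic_in_closure_rat_points pos) (auto intro: add_pos_pos)
    moreover have lim: "(\<lambda>n. x + 1 / real (Suc n)) \<longlonglongrightarrow> x"
      using tendsto_add[OF tendsto_const LIMSEQ_Suc[OF lim_1_over_n], of x] by simp
    have "(\<lambda>n. (x + 1 / real (Suc n), s * sqrt (cubic (x + 1 / real (Suc n))))) \<longlonglongrightarrow>
        (x, s * sqrt (cubic x))"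
      by (intro tendsto_intros lim isCont_tendsto_compose[OF isCont_cubic lim])
    ultimately show ?thesis
      unfolding y by (rule closed_sequentially[OF closed_closure])
  qed
qed

text \<open>Translation by the 2-torsion point (0, 0) exchanges the two real components.\<close>

lemma cubic_translate_torsion:
  assumes "x \<noteq> 0" "y^2 = cubic x"
  shows "(32 * y / x^2)^2 = cubic (- 32 / x)"
proof -
  have "(32 * y / x^2)^2 = 1024 * y^2 / x^4"
    by (simp add: power_divide power_mult_distrib flip: power_mult)
  then show ?thesis
    unfolding assms(2) cubic_def using assms(1)
    by (simp add: field_simps power2_eq_square power3_eq_cube power4_eq_xxxx)
qed

lemma closure_rat_points:
  assumes "y^2 = cubic x"
  shows "(x, y) \<in> closure rat_points"
proof -
  consider "x > 0" | "x = 0" | "x < 0"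
    by linarith
  then show ?thesis
  proof cases
    case 1
    then show ?thesis
      using closure_rat_points_pos assms by blast
  next
    case 2
    then have "y = 0"
      using assms unfolding cubic_def by simp
    then have "(x, y) \<in> rat_points"
      using 2 unfolding rat_points_def cubic_def by simp
    then show ?thesis
      using closure_subset by blast
  next
    case 3
    \<comment> \<open>The point is on the oval. Its translate lies on the unbounded branch, and the
      involution \<open>\<tau>\<close> carries an approximating sequence back.\<close>
    define x' y' where "x' = - 32 / x" and "y' = 32 * y / x^2"
    have x': "x' > 0"
      unfolding x'_def using 3 by (simp add: divide_pos_neg)
    have "y'^2 = cubic x'"
      unfolding x'_def y'_def using cubic_translate_torsion 3 assms by simp
    then have "(x', y') \<in> closure rat_points"
      using closure_rat_points_pos x' by blast
    then obtain p where p: "p n \<in> rat_points" "p \<longlonglongrightarrow> (x', y')" for n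
      unfolding closure_sequential by blast
    define \<tau> :: "real \<times> real \<Rightarrow> real \<times> real"
      where "\<tau> = (\<lambda>z. (- 32 / fst z, 32 * snd z / fst z^2))"
    have "\<tau> z \<in> rat_points" if "z \<in> rat_points" for z
    proof (cases "fst z = 0")
      \<comment> \<open>Division by zero yields 0, so \<open>\<tau>\<close> sends this point to (0,
        0), again a rational point.\<close>
      case True
      then show ?thesis
        unfolding \<tau>_def rat_points_def cubic_def by simp
    next
      case False
      then show ?thesis
        using that cubic_translate_torsion[OF False] unfolding \<tau>_def rat_points_def by auto
    qed
    moreover have "(\<lambda>n. \<tau> (p n)) \<longlonglongrightarrow> \<tau> (x', y')"
      unfolding \<tau>_def using x' by (auto intro!: tendsto_intros tendsto_eq_intros p(2))
    moreover have "\<tau> (x', y') = (x, y)"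
      unfolding \<tau>_def x'_def y'_def using 3 by (simp add: field_simps power2_eq_square)
    ultimately show ?thesis
      using p(1) unfolding closure_sequential by metis
  qed
qed

section \<open>Density on the projective cubic\<close>

text \<open>The Weierstrass coordinates (x, y) are obtained by sending the inflectional tangent
  c + 2 (a + b) = 0 at the flex (1 : -1 : 0) to infinity; on the image of this map
  the form c + 2 (a + b) is constantly 24.\<close>

lemma span_singleton_scaleR:
  fixes v :: "'a::real_vector"
  assumes "k \<noteq> 0"
  shows "span {k *\<^sub>R v} = span {v}"
  using assms span_image_scale[of "{v}" "\<lambda>_. k"] by simp

definition of_weierstrass :: "real \<Rightarrow> real \<Rightarrow> real^3" where
  "of_weierstrass x y = vector [8 - x + y, 8 - x - y, 4 * x - 8]"

lemma of_weierstrass_nth [simp]: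
  "of_weierstrass x y $ 1 = 8 - x + y" "of_weierstrass x y $ 2 = 8 - x - y"
  "of_weierstrass x y $ 3 = 4 * x - 8"
  by (simp_all add: of_weierstrass_def vector_3)

lemma of_weierstrass_nonzero [simp]: "of_weierstrass x y \<noteq> 0"
proof
  assume "of_weierstrass x y = 0"
  then have "8 - x + y = 0" "8 - x - y = 0" "4 * x - 8 = 0"
    by (metis of_weierstrass_nth zero_index)+
  then show False
    by simp
qed

lemma q_weierstrass:
  "q (8 - x + y) (8 - x - y) (4 * x - 8) = 24 * (y^2 - (x^3 + 5 * x^2 - 32 * x))"
  for x y :: real
  unfolding q_def by algebra

lemma q_of_weierstrass_eq_0_iff:
  "q (of_weierstrass x y $ 1) (of_weierstrass x y $ 2) (of_weierstrass x y $ 3) = 0 \<longleftrightarrow> y^2 = cubic x"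
  unfolding of_weierstrass_nth q_weierstrass cubic_def[symmetric] by simp

lemma q_zero_cases:
  fixes v :: "real^3"
  assumes "v \<noteq> 0" "q (v$1) (v$2) (v$3) = 0"
  obtains "span {v} = span {vector [1, - 1, 0]}"
  | x y where "span {v} = span {of_weierstrass x y}" "y^2 = cubic x"
proof (cases "v$3 + 2 * (v$1 + v$2) = 0")
  case True
  then have c: "v$3 = - 2 * (v$1 + v$2)"
    by linarith
  \<comment> \<open>On the inflectional tangent \<open>q\<close> is a multiple of a cube, so the
    tangent meets the curve only at the flex.\<close>
  have "q (v$1) (v$2) (v$3) = 3 * (v$1 + v$2)^3"
    unfolding q_def c by algebra
  then have "v$2 = - v$1"
    using assms(2) by simp
  moreover from this have "v$3 = 0"
    using c by simp
  ultimately have v: "v = (v$1) *\<^sub>R vector [1, - 1, 0]"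
    by (simp add: vec_eq_iff forall_3 vector_3)
  then have "v$1 \<noteq> 0"
    using assms(1) by force
  then have "span {v} = span {vector [1, - 1, 0]}"
    using v span_singleton_scaleR by metis
  then show ?thesis
    using that(1) by blast
next
  case False
  \<comment> \<open>Rescaling makes the form \<open>c + 2 * (a + b)\<close> equal to 24;
    \<open>x\<close> and \<open>y\<close> are then read off from the third coordinate and the
    difference of the first two.\<close>
  define k where "k = 24 / (v$3 + 2 * (v$1 + v$2))"
  define x where "x = (k * v$3 + 8) / 4"
  define y where "y = k * (v$1 - v$2) / 2"
  have "k \<noteq> 0"
    using False unfolding k_def by simp
  have "k * (v$3 + 2 * (v$1 + v$2)) = 24"
    using False unfolding k_def by (simp only: times_divide_eq_left nonzero_mult_div_cancel_right not_False_eq_True)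
  then have kv: "k *\<^sub>R v = of_weierstrass x y"
    by (simp add: vec_eq_iff forall_3 x_def y_def field_simps)
  have "q (k * v$1) (k * v$2) (k * v$3) = 0"
    using assms(2) by (simp add: q_homogeneous)
  moreover have "k * v$1 = of_weierstrass x y $ 1" "k * v$2 = of_weierstrass x y $ 2"
    "k * v$3 = of_weierstrass x y $ 3"
    unfolding kv[symmetric] by simp_all
  ultimately have "y^2 = cubic x"
    by (simp only: q_of_weierstrass_eq_0_iff)
  moreover have "span {v} = span {of_weierstrass x y}"
    unfolding kv[symmetric] using \<open>k \<noteq> 0\<close> by (simp add: span_singleton_scaleR)
  ultimately show ?thesis
    using that(2) by blast
qed

lemma E_rat_dense: "(subtopology proj_plane_topology E_real) closure_of E_rat = E_real"
proof -
  have sub: "E_rat \<subseteq> E_real" "E_real \<subseteq> proj_plane"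
    unfolding E_rat_def E_real_def proj_plane_def by auto
  have "L \<in> (subtopology proj_plane_topology E_real) closure_of E_rat" if L: "L \<in> E_real" for L
  proof -
    obtain v where v: "L = span {v}" "v \<noteq> 0" "q (v$1) (v$2) (v$3) = 0"
      using L unfolding E_real_def by blast
    from v(2,3) consider "L = span {vector [1, - 1, 0]}"
      | x y where "L = span {of_weierstrass x y}" "y^2 = cubic x"
      unfolding v(1) by (rule q_zero_cases) auto
    then show ?thesis
    proof cases
      \<comment> \<open>The flex itself has rational coordinates.\<close>
      case 1
      have "(vector [1, - 1, 0] :: real^3) \<noteq> 0"
        by (simp add: vec_eq_iff forall_3 vector_3)
      moreover have "\<forall>i. (vector [1, - 1, 0] :: real^3) $ i \<in> \<rat>"
        by (simp add: forall_3 vector_3)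
      moreover have "q ((vector [1, - 1, 0] :: real^3) $ 1) ((vector [1, - 1, 0] :: real^3) $ 2)
          ((vector [1, - 1, 0] :: real^3) $ 3) = 0"
        by (simp add: vector_3 q_def)
      ultimately have "L \<in> E_rat"
        unfolding 1 E_rat_def by blast
      then show ?thesis
        using closure_of_subset[of E_rat "subtopology proj_plane_topology E_real"] sub by auto
    next
      case 2
      show ?thesis
        unfolding in_closure_of
      proof (intro conjI allI impI)
        show "L \<in> topspace (subtopology proj_plane_topology E_real)"
          using L sub by auto
        fix T assume "L \<in> T \<and> openin (subtopology proj_plane_topology E_real) T"
        then obtain U where U: "openin proj_plane_topology U" "T = U \<inter> E_real" "L \<in> U"
          unfolding openin_subtopology by blast
        \<comment> \<open>The cone over \<open>U\<close> is open by the quotient topology, so the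
          approximation can take place in 3-space.\<close>
        define O' where "O' = {w \<in> - {0 :: real^3}. span {w} \<in> U}"
        have "open O'"
          using U(1) unfolding O'_def openin_proj_plane_topology
          by (simp add: openin_open_eq open_Compl)
        obtain p where p: "\<And>n. p n \<in> rat_points" "p \<longlonglongrightarrow> (x, y)"
          using closure_rat_points[OF 2(2)] unfolding closure_sequential by blast
        have "(\<lambda>n. of_weierstrass (fst (p n)) (snd (p n))) \<longlonglongrightarrow> of_weierstrass x y"
        proof (rule vec_tendstoI)
          fix i :: 3
          have px: "(\<lambda>n. fst (p n)) \<longlonglongrightarrow> x" and py: "(\<lambda>n. snd (p n)) \<longlonglongrightarrow> y"
            using tendsto_fst[OF p(2)] tendsto_snd[OF p(2)] by auto
          show "(\<lambda>n. of_weierstrass (fst (p n)) (snd (p n)) $ i) \<longlonglongrightarrow> of_weierstrass x y $ i"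
            using exhaust_3[of i] by (elim disjE; simp; intro tendsto_intros px py)
        qed
        moreover have "of_weierstrass x y \<in> O'"
          using U(3) 2(1) unfolding O'_def by simp
        ultimately have "eventually (\<lambda>n. of_weierstrass (fst (p n)) (snd (p n)) \<in> O') sequentially"
          using topological_tendstoD \<open>open O'\<close> by blast
        then obtain n where n: "of_weierstrass (fst (p n)) (snd (p n)) \<in> O'"
          using eventually_happens'[OF sequentially_bot] by blast
        define w where "w = of_weierstrass (fst (p n)) (snd (p n))"
        have pn: "fst (p n) \<in> \<rat>" "snd (p n) \<in> \<rat>" "snd (p n)^2 = cubic (fst (p n))"
          using p(1)[of n] unfolding rat_points_def by auto
        have "q (w$1) (w$2) (w$3) = 0"
          unfolding w_def q_of_weierstrass_eq_0_iff by (rule pn(3))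
        moreover have "\<forall>i. w$i \<in> \<rat>"
          unfolding w_def using pn by (simp add: forall_3)
        moreover have "w \<noteq> 0"
          unfolding w_def by simp
        ultimately have "span {w} \<in> E_rat"
          unfolding E_rat_def by blast
        moreover have "span {w} \<in> T"
          using n sub \<open>span {w} \<in> E_rat\<close> unfolding U(2) O'_def w_def by blast
        ultimately show "\<exists>y. y \<in> E_rat \<and> y \<in> T"
          by blast
      qed
    qed
  qed
  moreover have "(subtopology proj_plane_topology E_real) closure_of E_rat \<subseteq> E_real"
    by (rule order_trans[OF closure_of_subset_topspace]) auto
  ultimately show ?thesis
    by blast
qed

section \<open>Bisectral triangles\<close>

text \<open>Angle bisector theorem: the foot divides \<open>BC\<close> in the ratio
  \<open>AB : AC\<close>.\<close>

definition foot :: "real^2 \<Rightarrow> real^2 \<Rightarrow> real^2 \<Rightarrow> real^2" where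
  "foot A B C = B + (dist A B / (dist A B + dist C A)) *\<^sub>R (C - B)"

lemma bisector_foot_foot:
  assumes "A \<noteq> B" "A \<noteq> C"
  shows "bisector_foot A B C (foot A B C)"
proof -
  define U V b c where "U = B - A" and "V = C - A" and "b = dist C A" and "c = dist A B"
  have bc: "b > 0" "c > 0"
    using assms unfolding b_def c_def by auto
  have norms: "norm U = c" "norm V = b"
    unfolding U_def V_def b_def c_def by (auto simp: dist_norm norm_minus_commute)
  define w where "w = c / (c + b)"
  have w: "0 \<le> w" "w \<le> 1" "1 - w = b / (c + b)"
    using bc unfolding w_def by (auto simp: field_simps)
  have foot: "foot A B C = (1 - w) *\<^sub>R B + w *\<^sub>R C"
    unfolding foot_def b_def[symmetric] c_def[symmetric] w_def[symmetric] by (simp add: algebra_simps)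
  then have "foot A B C \<in> closed_segment B C"
    unfolding in_segment using w by blast
  moreover have "angle_at B A (foot A B C) = angle_at (foot A B C) A C"
  proof -
    define N where "N = norm (foot A B C - A)"
    have D: "foot A B C - A = (1 - w) *\<^sub>R U + w *\<^sub>R V"
      unfolding foot U_def V_def by (simp add: algebra_simps)
    have "U \<bullet> U = c^2" "V \<bullet> V = b^2"
      using norms by (simp_all add: dot_square_norm)
    \<comment> \<open>The two products differ only in the factors \<open>c\<close> and
      \<open>b\<close>, the norms of \<open>U\<close> and \<open>V\<close>, so the two cosines
      agree.\<close>
    then have "U \<bullet> (foot A B C - A) = c * ((b * c + U \<bullet> V) / (c + b))"
      "(foot A B C - A) \<bullet> V = b * ((b * c + U \<bullet> V) / (c + b))"
      unfolding D inner_add_left inner_add_right inner_scaleR_left inner_scaleR_right w(3)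
      unfolding w_def by (simp_all add: add_divide_distrib distrib_left power2_eq_square ac_simps)
    then show ?thesis
      unfolding angle_at_def U_def[symmetric] V_def[symmetric] norms N_def[symmetric]
      using bc by simp
  qed
  ultimately show ?thesis
    unfolding bisector_foot_def by blast
qed

text \<open>With \<open>B\<close> as origin the two feet are multiples of \<open>U\<close> and
  \<open>V\<close>; the law of cosines expresses their inner product through the sides.\<close>

lemma dist_feet_squared:
  assumes "A \<noteq> B" "B \<noteq> C" "C \<noteq> A"
  defines "a \<equiv> dist B C" and "b \<equiv> dist C A" and "c \<equiv> dist A B"
  shows "(dist (foot C A B) (foot A B C))^2 =
    a * c * (a * c * ((a + b)^2 + (b + c)^2) - (a^2 + c^2 - b^2) * (b + c) * (a + b))
      / ((b + c)^2 * (a + b)^2)"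
proof -
  have pos: "a > 0" "b > 0" "c > 0"
    using assms by auto
  define U V where "U = C - B" and "V = A - B"
  define p r where "p = c / (b + c)" and "r = a / (a + b)"
  have weight: "b / (b + a) = 1 - r"
    using pos unfolding r_def by (auto simp: field_simps)
  have "foot A B C - B = p *\<^sub>R U"
    unfolding foot_def U_def p_def b_def c_def by (simp add: add.commute)
  moreover have "foot C A B - B = r *\<^sub>R V"
    unfolding foot_def a_def[symmetric] b_def[symmetric] V_def weight by (simp add: algebra_simps)
  ultimately have "foot C A B - foot A B C = r *\<^sub>R V - p *\<^sub>R U"
    by (metis add_diff_cancel_right' diff_add_cancel diff_diff_eq2)
  then have "(dist (foot C A B) (foot A B C))^2 = (r *\<^sub>R V - p *\<^sub>R U) \<bullet> (r *\<^sub>R V - p *\<^sub>R U)"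
    by (simp add: dist_norm dot_square_norm)
  also have "\<dots> = r^2 * (V \<bullet> V) + p^2 * (U \<bullet> U) - p * r * (2 * (U \<bullet> V))"
    by (simp add: inner_diff_left inner_diff_right inner_commute algebra_simps power2_eq_square)
  finally have dist: "(dist (foot C A B) (foot A B C))^2 =
      r^2 * (V \<bullet> V) + p^2 * (U \<bullet> U) - p * r * (2 * (U \<bullet> V))" .
  have VV: "V \<bullet> V = c^2" and UU: "U \<bullet> U = a^2"
    unfolding U_def V_def a_def c_def by (simp_all add: dist_norm dot_square_norm norm_minus_commute)
  have "b^2 = (V - U) \<bullet> (V - U)"
    unfolding U_def V_def b_def by (simp add: dist_norm dot_square_norm norm_minus_commute)
  then have UV: "2 * (U \<bullet> V) = a^2 + c^2 - b^2"
    using UU VV by (simp add: inner_diff_left inner_diff_right inner_commute)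
  have "(a / t)^2 * c^2 + (c / s)^2 * a^2 - c / s * (a / t) * k =
      a * c * (a * c * (t^2 + s^2) - k * s * t) / (s^2 * t^2)" if "s > 0" "t > 0" for s t k :: real
    using that by (simp add: field_simps power2_eq_square)
  then show ?thesis
    unfolding dist UU VV UV p_def r_def using pos by simp
qed

text \<open>The difference of the two squared lengths, cleared of denominators, factors as
  \<open>q\<close> times \<open>a - b\<close> and factors positive up to sign; \<open>M'\<close> is
  \<open>M\<close> with the vertices permuted cyclically.\<close>

lemma isosceles_feet:
  assumes "A \<noteq> B" "B \<noteq> C" "C \<noteq> A" "q (dist B C) (dist C A) (dist A B) = 0"
  shows "dist (foot B C A) (foot C A B) = dist (foot C A B) (foot A B C)"
proof -
  define a b c where "a = dist B C" and "b = dist C A" and "c = dist A B"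
  have pos: "a > 0" "b > 0" "c > 0"
    using assms unfolding a_def b_def c_def by auto
  define M where "M = a * c * ((a + b)^2 + (b + c)^2) - (a^2 + c^2 - b^2) * (b + c) * (a + b)"
  define M' where "M' = c * b * ((c + a)^2 + (a + b)^2) - (c^2 + b^2 - a^2) * (a + b) * (c + a)"
  have "a * (c + a)^2 * M - b * (b + c)^2 * M' = - (a - b) * a * b * (a + b) * q a b c"
    unfolding M_def M'_def q_def by algebra
  then have "a * (c + a)^2 * M = b * (b + c)^2 * M'"
    using assms(4) unfolding a_def b_def c_def by simp
  moreover have "b + c \<noteq> 0" "a + b \<noteq> 0" "c + a \<noteq> 0"
    using pos by auto
  ultimately have "a * c * M / ((b + c)^2 * (a + b)^2) = c * b * M' / ((a + b)^2 * (c + a)^2)"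
    by (simp add: frac_eq_eq) algebra
  then have "(dist (foot C A B) (foot A B C))^2 = (dist (foot B C A) (foot C A B))^2"
    using dist_feet_squared[OF assms(1-3)] dist_feet_squared[OF assms(3,1,2)]
    unfolding M_def M'_def a_def[symmetric] b_def[symmetric] c_def[symmetric] by simp
  then show ?thesis
    by simp
qed

section \<open>Triangles with prescribed sides and a similarity invariant\<close>

lemma triangle_with_sides:
  fixes a b c :: real
  assumes "a > 0" "b > 0" "c > 0" "a < b + c" "b < c + a" "c < a + b"
  obtains A B C :: "real^2" where "\<not> collinear {A, B, C}" "dist B C = a" "dist C A = b" "dist A B = c"
proof -
  \<comment> \<open>\<open>A\<close> is the origin and \<open>B\<close> lies on the first axis; the
    law of cosines gives the abscissa \<open>p\<close> of \<open>C\<close>.\<close>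
  define p where "p = (b^2 + c^2 - a^2) / (2 * c)"
  define h where "h = sqrt (b^2 - p^2)"
  define B C :: "real^2" where "B = vector [c, 0]" and "C = vector [p, h]"
  \<comment> \<open>Heron's formula: the triangle inequalities make the height real and
    positive.\<close>
  have "4 * c^2 * (b^2 - p^2) = (a + b + c) * (b + c - a) * (c + a - b) * (a + b - c)"
  proof -
    have "2 * c * p = b^2 + c^2 - a^2"
      unfolding p_def using assms(3) by simp
    then show ?thesis
      by algebra
  qed
  moreover have "(a + b + c) * (b + c - a) * (c + a - b) * (a + b - c) > 0"
    using assms by simp
  ultimately have "b^2 - p^2 > 0"
    using assms(3) by (metis zero_less_mult_pos zero_less_power zero_less_numeral mult_pos_pos)
  then have h: "h > 0" "h^2 = b^2 - p^2"
    unfolding h_def by auto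
  have "(c - p)^2 + h^2 = a^2"
    unfolding h(2) p_def using assms(3) by (simp add: field_simps power2_eq_square)
  then have "dist B C = a" "dist C 0 = b" "dist 0 B = c"
    using assms h(2) unfolding B_def C_def
    by (simp_all add: dist_vec_def L2_set_def sum_2 vector_2 dist_real_def)
  moreover have "\<not> collinear {0, B, C}"
  proof
    assume "collinear {0, B, C}"
    then consider "B = 0" | "C = 0" | k where "C = k *\<^sub>R B"
      unfolding collinear_lemma by blast
    then show False
    proof cases
      case 1
      then have "B $ 1 = 0" by simp
      then show ?thesis using assms(3) by (simp add: B_def vector_2)
    next
      case 2
      then have "C $ 2 = 0" by simp
      then show ?thesis using h(1) by (simp add: C_def vector_2)
    next
      case 3
      then have "C $ 2 = k * B $ 2" by simp
      then show ?thesis using h(1) by (simp add: B_def C_def vector_2)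
    qed
  qed
  ultimately show ?thesis
    using that by blast
qed

lemma sharygin_if_q:
  assumes "\<not> collinear {A, B, C}" "scalene A B C" "q (dist B C) (dist C A) (dist A B) = 0"
  shows "sharygin A B C"
proof -
  have "A \<noteq> B" "B \<noteq> C" "C \<noteq> A"
    using assms(1) by (auto simp: insert_commute)
  then show ?thesis
    using assms isosceles_feet[of A B C] bisector_foot_foot
    unfolding sharygin_def isosceles_def by metis
qed

text \<open>Similarity forgets the order of vertices, so the proof compares quantities of the vertex
  sets: the sum of all distances and the largest distance both scale by \<open>k\<close>.\<close>

lemma similar_triangles_ratio:
  assumes sim: "similar_triangles (A, B, C) (A', B', C')"
    and distinct: "A \<noteq> B" "B \<noteq> C" "C \<noteq> A" "A' \<noteq> B'" "B' \<noteq> C'" "C' \<noteq> A'"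
    and longest: "dist B C \<le> dist A B" "dist C A \<le> dist A B"
    and longest': "dist B' C' \<le> dist A' B'" "dist C' A' \<le> dist A' B'"
  shows "(dist B C + dist C A + dist A B) * dist A' B' = (dist B' C' + dist C' A' + dist A' B') * dist A B"
proof -
  obtain f k where k: "k > 0" and f: "\<And>x y. dist (f x) (f y) = k * dist x y"
    and im: "f ` {A, B, C} = {A', B', C'}"
    using sim unfolding similar_triangles_def by auto
  have "inj f"
    using f k by (metis dist_eq_0_iff injI mult_eq_0_iff less_irrefl)
  then have inj: "inj_on f S" for S
    by (rule inj_on_subset) simp
  \<comment> \<open>Summing over ordered pairs counts every side twice.\<close>
  have sums: "(\<Sum>x\<in>{P, Q, R}. \<Sum>y\<in>{P, Q, R}. dist x y) = 2 * (dist Q R + dist R P + dist P Q)"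
    if "P \<noteq> Q" "Q \<noteq> R" "R \<noteq> P" for P Q R :: "real^2"
    using that by (simp add: dist_commute[of R P] dist_commute[of Q P] dist_commute[of R Q])
  have "(\<Sum>x\<in>{A', B', C'}. \<Sum>y\<in>{A', B', C'}. dist x y) = k * (\<Sum>x\<in>{A, B, C}. \<Sum>y\<in>{A, B, C}. dist x y)"
    unfolding im[symmetric] by (simp only: sum.reindex[OF inj] o_def f sum_distrib_left)
  then have perimeter: "dist B' C' + dist C' A' + dist A' B' = k * (dist B C + dist C A + dist A B)"
    unfolding sums[OF distinct(1-3)] sums[OF distinct(4-6)] by (simp add: algebra_simps)
  have le: "dist x y \<le> dist A B" if "x \<in> {A, B, C}" "y \<in> {A, B, C}" for x y
    using that longest by (auto simp: dist_commute)
  have le': "dist x y \<le> dist A' B'" if "x \<in> {A', B', C'}" "y \<in> {A', B', C'}" for x y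
    using that longest' by (auto simp: dist_commute)
  have "A' \<in> f ` {A, B, C}" "B' \<in> f ` {A, B, C}"
    unfolding im by auto
  then obtain x y where "x \<in> {A, B, C}" "y \<in> {A, B, C}" "A' = f x" "B' = f y"
    by blast
  then have "dist A' B' \<le> k * dist A B"
    using le k f by simp
  moreover have "f A \<in> {A', B', C'}" "f B \<in> {A', B', C'}"
    unfolding im[symmetric] by auto
  then have "k * dist A B \<le> dist A' B'"
    using le' f by metis
  ultimately have "dist A' B' = k * dist A B"
    by simp
  then show ?thesis
    unfolding perimeter by simp
qed

section \<open>Integer Sharygin triangles\<close>

lemma weierstrass_triangle_ineqs:
  assumes "3 < x" "x < 4" "y > 0" "y^2 = cubic x"
  defines "a \<equiv> 8 - x + y" and "b \<equiv> 8 - x - y" and "c \<equiv> 4 * x - 8"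
  shows "0 < b" "b < a" "a < c" "c < a + b" "a < b + c"
proof -
  have "y^2 > 0"
    using assms(3) by simp
  then have "x^2 + 5 * x - 32 > 0"
    using assms cubic_pos_iff[of x] by simp
  moreover have "x^2 < 4 * x"
    using assms(1,2) by (simp add: power2_eq_square)
  ultimately have "5 * x - 16 > 0"
    using assms(1,2) by linarith
  \<comment> \<open>\<open>y < 5 * x - 16\<close> is \<open>a < c\<close> and
    \<open>y < 2 * x - 4\<close> is \<open>a < b + c\<close>, while \<open>x < 4\<close> is
    \<open>c < a + b\<close>.\<close>
  have "(5 * x - 16)^2 - y^2 = (4 - x) * (x - 8)^2"
    unfolding assms(4) cubic_def by algebra
  moreover have "(4 - x) * (x - 8)^2 > 0"
    using assms(2) by simp
  ultimately have "y^2 < (5 * x - 16)^2"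
    by linarith
  then have "y < 5 * x - 16"
    using \<open>5 * x - 16 > 0\<close> power2_less_imp_less[of y] by simp
  have "(2 * x - 4)^2 - y^2 = (x + 1) * ((4 - x) * (4 + x))"
    unfolding assms(4) cubic_def by algebra
  moreover have "(x + 1) * ((4 - x) * (4 + x)) > 0"
    using assms(1,2) by simp
  ultimately have "y^2 < (2 * x - 4)^2"
    by linarith
  then have "y < 2 * x - 4"
    using assms(1) power2_less_imp_less[of y] by simp
  with \<open>y < 5 * x - 16\<close> show "0 < b" "b < a" "a < c" "c < a + b" "a < b + c"
    using assms(1-3) unfolding a_def b_def c_def by linarith+
qed

lemma Rats_common_denominator:
  fixes x y :: real
  assumes "x \<in> \<rat>" "y \<in> \<rat>"
  obtains n :: nat where "n > 0" "real n * x \<in> \<int>" "real n * y \<in> \<int>"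
proof -
  obtain p k where k: "k > 0" "x = real_of_int p / real k"
    using assms(1) unfolding Rats_eq_int_div_nat by blast
  obtain r m where m: "m > 0" "y = real_of_int r / real m"
    using assms(2) unfolding Rats_eq_int_div_nat by blast
  have "real (k * m) * x = of_int (p * int m)" "real (k * m) * y = of_int (r * int k)"
    using k m by (auto simp: field_simps)
  then have "real (k * m) * x \<in> \<int>" "real (k * m) * y \<in> \<int>"
    by (metis Ints_of_int)+
  then show ?thesis
    using that[of "k * m"] k m by simp
qed

text \<open>The Weierstrass coordinates, scaled by a common denominator, serve as sides. Before
  scaling the perimeter is \<open>2 * x + 8\<close> and the longest side \<open>4 * x - 8\<close>,
  whence the last equation.\<close>

lemma sharygin_of_rat_abscissa:
  assumes "x \<in> rat_abscissae" "x < 4"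
  obtains A B C where "integer_sharygin A B C" "dist B C < dist A B" "dist C A < dist A B"
    "(dist B C + dist C A + dist A B) * (4 * x - 8) = dist A B * (2 * x + 8)"
proof -
  obtain y where y: "y \<in> \<rat>" "y > 0" "y^2 = cubic x"
    using assms(1) unfolding rat_abscissae_def by blast
  obtain n :: nat where n: "n > 0" "real n * x \<in> \<int>" "real n * y \<in> \<int>"
    using Rats_common_denominator[OF rat_abscissaeD(1)[OF assms(1)] y(1)] by blast
  define a b c where "a = 8 - x + y" and "b = 8 - x - y" and "c = 4 * x - 8"
  have ineqs: "0 < b" "b < a" "a < c" "c < a + b" "a < b + c"
    using weierstrass_triangle_ineqs[OF rat_abscissaeD(2)[OF assms(1)] assms(2) y(2,3)]
    unfolding a_def b_def c_def .
  have scaled: "n * a > 0" "n * b > 0" "n * c > 0" "n * b < n * a" "n * a < n * c"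
    "n * a < n * b + n * c" "n * c < n * a + n * b"
    using ineqs n(1) by (simp_all flip: distrib_left)
  obtain A B C :: "real^2" where nondeg: "\<not> collinear {A, B, C}"
    and sides: "dist B C = n * a" "dist C A = n * b" "dist A B = n * c"
    using triangle_with_sides[of "n * a" "n * b" "n * c"] scaled by (smt (verit))
  have "q a b c = 0"
    unfolding a_def b_def c_def q_weierstrass using y(3) by (simp add: cubic_def)
  then have "q (dist B C) (dist C A) (dist A B) = 0"
    unfolding sides q_homogeneous by simp
  moreover have "scalene A B C"
    unfolding scalene_def sides using ineqs n(1) by simp
  ultimately have "sharygin A B C"
    using nondeg sharygin_if_q by blast
  moreover have "n * a = 8 * real n - n * x + n * y" "n * b = 8 * real n - n * x - n * y"
    "n * c = 4 * (n * x) - 8 * real n"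
    unfolding a_def b_def c_def by (simp_all add: algebra_simps)
  then have "n * a \<in> \<int>" "n * b \<in> \<int>" "n * c \<in> \<int>"
    using n by simp_all
  ultimately have "integer_sharygin A B C"
    unfolding integer_sharygin_def sides by blast
  moreover have "(n * a + n * b + n * c) * (4 * x - 8) = n * c * (2 * x + 8)"
    unfolding a_def b_def c_def by algebra
  ultimately show ?thesis
    using that[of A B C] scaled unfolding sides by simp
qed

lemma infinite_rat_abscissae_less_4: "infinite {x \<in> rat_abscissae. x < 4}"
proof
  assume fin: "finite {x \<in> rat_abscissae. x < 4}"
  \<comment> \<open>37/10 lies just right of the positive root of \<open>cubic\<close>. Inserting 4
    makes the set nonempty and bounds its minimum; density then yields a smaller element.\<close>
  define r where "r = Min (insert 4 {x \<in> rat_abscissae. x < 4 \<and> x > 37 / 10})"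
  have fin': "finite (insert 4 {x \<in> rat_abscissae. x < 4 \<and> x > 37 / 10})"
    using finite_subset[OF _ fin] by (simp add: Collect_mono subset_iff)
  have "r > 37 / 10"
    unfolding r_def using fin' by (subst Min_gr_iff) auto
  moreover have "cubic (37 / 10) > 0"
    by (simp add: cubic_def power2_eq_square power3_eq_cube)
  ultimately obtain x where x: "x \<in> rat_abscissae" "37 / 10 < x" "x < r"
    using rat_abscissae_dense[of "37 / 10" r] by auto
  have "r \<le> 4"
    unfolding r_def using fin' by (intro Min_le) auto
  then have "r \<le> x"
    unfolding r_def using fin' x by (intro Min_le) (auto simp: r_def)
  then show False
    using x(3) by simp
qed

lemma infinitely_many_integer_sharygin:
  "\<exists>\<T>. infinite \<T> \<and> (\<forall>(A, B, C) \<in> \<T>. integer_sharygin A B C) \<and>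
    pairwise (\<lambda>T T'. \<not> similar_triangles T T') \<T>"
proof -
  define X where "X = {x \<in> rat_abscissae. x < 4}"
  have "\<forall>x\<in>X. \<exists>A B C. integer_sharygin A B C \<and> dist B C < dist A B \<and> dist C A < dist A B \<and>
    (dist B C + dist C A + dist A B) * (4 * x - 8) = dist A B * (2 * x + 8)"
    unfolding X_def using sharygin_of_rat_abscissa by blast
  then obtain A B C where ABC: "\<And>x. x \<in> X \<Longrightarrow> integer_sharygin (A x) (B x) (C x)"
    "\<And>x. x \<in> X \<Longrightarrow> dist (B x) (C x) < dist (A x) (B x)"
    "\<And>x. x \<in> X \<Longrightarrow> dist (C x) (A x) < dist (A x) (B x)"
    "\<And>x. x \<in> X \<Longrightarrow> (dist (B x) (C x) + dist (C x) (A x) + dist (A x) (B x)) * (4 * x - 8) =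
      dist (A x) (B x) * (2 * x + 8)"
    by metis
  define T where "T = (\<lambda>x. (A x, B x, C x))"
  have eq: "x = x'" if x: "x \<in> X" "x' \<in> X" and sim: "similar_triangles (T x) (T x')" for x x'
  proof -
    have distinct: "A x \<noteq> B x" "B x \<noteq> C x" "C x \<noteq> A x" if "x \<in> X" for x
      using ABC(1)[OF that] unfolding integer_sharygin_def sharygin_def by (auto simp: insert_commute)
    define c c' where "c = dist (A x) (B x)" and "c' = dist (A x') (B x')"
    define s s' where "s = dist (B x) (C x) + dist (C x) (A x) + c"
      and "s' = dist (B x') (C x') + dist (C x') (A x') + c'"
    have "c > 0" "c' > 0"
      using distinct x unfolding c_def c'_def by auto
    have "s * c' = s' * c"
      using similar_triangles_ratio[OF sim[unfolded T_def]] distinct x ABC(2,3)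
      unfolding s_def s'_def c_def c'_def by (simp add: less_imp_le)
    moreover have "s * (4 * x - 8) = c * (2 * x + 8)" "s' * (4 * x' - 8) = c' * (2 * x' + 8)"
      using ABC(4) x unfolding s_def s'_def c_def c'_def by auto
    ultimately have "c * c' * (2 * x + 8) * (4 * x' - 8) = c * c' * (2 * x' + 8) * (4 * x - 8)"
      by algebra
    \<comment> \<open>The ratio of perimeter to longest side is a fractional linear function of
      \<open>x\<close>, hence determines \<open>x\<close>.\<close>
    then have "(2 * x + 8) * (4 * x' - 8) = (2 * x' + 8) * (4 * x - 8)"
      using \<open>c > 0\<close> \<open>c' > 0\<close> by simp
    then show ?thesis
      by (simp add: algebra_simps)
  qed
  \<comment> \<open>Together with \<open>eq\<close>, reflexivity makes \<open>T\<close>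
    injective.\<close>
  have refl: "similar_triangles (T x) (T x)" for x
    unfolding similar_triangles_def T_def by (auto intro!: exI[of _ "\<lambda>z. z"] exI[of _ 1])
  have "inj_on T X"
    using eq refl by (metis inj_onI)
  then have "infinite (T ` X)"
    using infinite_rat_abscissae_less_4 finite_imageD unfolding X_def by blast
  moreover have "\<forall>(A, B, C) \<in> T ` X. integer_sharygin A B C"
    using ABC(1) unfolding T_def by auto
  moreover have "pairwise (\<lambda>T T'. \<not> similar_triangles T T') (T ` X)"
    using eq unfolding pairwise_def by blast
  ultimately show ?thesis
    by blast
qed

theorem theorem4p6:
  shows "(subtopology proj_plane_topology E_real) closure_of E_rat = E_real \<and>
    (\<exists>\<T>. infinite \<T> \<and>
       (\<forall>(A, B, C) \<in> \<T>. integer_sharygin A B C) \<and>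
       pairwise (\<lambda>T T'. \<not> similar_triangles T T') \<T>)"
  using E_rat_dense infinitely_many_integer_sharygin by blast

end
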